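(* Let $\psi\in\mathscr{P}(\mathbb{R})$, $f\in\mathscr{P}'(\mathbb{R})$, and let $\mu_\alpha=\langle f,x^\alpha\rangle$ ($\alpha=0,1,2,\dots$) be the moment sequence of $f$. Then for every fixed $b\in\mathbb{R}$, $$\sqrt{a}\,\Big\langle f(ax),\psi\Big(x-\frac{b}{a}\Big)\Big\rangle\sim\sum_{\alpha=0}^{\infty}\frac{\mu_\alpha\, D^\alpha\psi(-b/a)}{\alpha!\,a^{\alpha+1/2}}\qquad\text{as } a\to\infty.$$
   Context: $\mathscr{P}(\mathbb{R})$ is the space of smooth functions $\phi$ on $\mathbb{R}$ such that $\lim_{|x|\to\infty}e^{-\gamma|x|}D^\beta\phi(x)=0$ for every $\gamma>0$ and every $\beta\in\mathbb{N}=\{0,1,2,\dots\}$, topologized by the seminorms $\|\phi\|_{\gamma,\beta}=\sup\{|e^{-\gamma|x|}D^\beta\phi(x)|:x\in\mathbb{R}\}$, $\gamma>0$, $\beta\in\mathbb{N}$. $\mathscr{P}'(\mathbb{R})$ is its dual (distributions of "less than exponential growth"). $D^\alpha$ is the $\alpha$-th derivative. $\langle\cdot,\cdot\rangle$ is the (bilinear) duality pairing in the variable $x$, and for $a>0$ the dilated distribution $f(ax)$ is defined by $\langle f(ax),\phi(x)\rangle=\frac1a\langle f(x),\phi(x/a)\rangle$. The left-hand side is the continuous wavelet transform $(W_\psi f)(a,b)$ of $f$ with respect to $\psi$, formally $\frac{1}{\sqrt a}\int f(x)\,\psi\big(\frac{x-b}{a}\big)\,dx$. The relation $\sim$ means asymptotic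 expansion with respect to the scale $a^{-\alpha-1/2}$: for every integer $N\ge 0$, the left-hand side minus the sum of the terms with $\alpha\le N$ is $o(a^{-N-1/2})$ as $a\to\infty$ (the coefficients $D^\alpha\psi(-b/a)$ may depend on $a$). *)

theory Defs
  imports "HOL-Analysis.Analysis" "HOL-Library.Landau_Symbols"
begin

definition iter_deriv :: "nat \<Rightarrow> (real \<Rightarrow> complex) \<Rightarrow> real \<Rightarrow> complex" where
  "iter_deriv n = (\<lambda>g x. vector_derivative g (at x)) ^^ n"

definition smooth :: "(real \<Rightarrow> complex) \<Rightarrow> bool" where
  "smooth \<phi> \<longleftrightarrow> (\<forall>n x. iter_deriv n \<phi> differentiable (at x))"

text \<open>On the real line, the filter \<open>at_infinity\<close> expresses the limit as the absolute value
  of the argument tends to infinity.\<close>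

definition test_space :: "(real \<Rightarrow> complex) set" where
  "test_space = {\<phi>. smooth \<phi> \<and>
     (\<forall>\<gamma>>0. \<forall>\<beta>. ((\<lambda>x. exp (- \<gamma> * \<bar>x\<bar>) *\<^sub>R iter_deriv \<beta> \<phi> x) \<longlongrightarrow> 0) at_infinity)}"

text \<open>The supremum is taken in the reals; for \<open>\<phi>\<close> in \<open>test_space\<close> and \<open>\<gamma> > 0\<close> it is over a
  bounded set.\<close>

definition test_seminorm :: "real \<Rightarrow> nat \<Rightarrow> (real \<Rightarrow> complex) \<Rightarrow> real" where
  "test_seminorm \<gamma> \<beta> \<phi> = (SUP x. norm (exp (- \<gamma> * \<bar>x\<bar>) *\<^sub>R iter_deriv \<beta> \<phi> x))"

text \<open>The locally convex topology of the seminorms: all open seminorm balls, with all centres,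
  form a subbase.\<close>

definition test_topology :: "(real \<Rightarrow> complex) topology" where
  "test_topology = topology_generated_by
     {{\<phi> \<in> test_space. test_seminorm \<gamma> \<beta> (\<lambda>x. \<phi> x - \<eta> x) < r} | \<eta> \<gamma> \<beta> r.
        \<eta> \<in> test_space \<and> 0 < \<gamma> \<and> 0 < r}"

lemma iter_deriv_zero [simp]: "iter_deriv n (\<lambda>x. 0) = (\<lambda>x. 0)"
  by (induction n) (simp_all add: iter_deriv_def)

lemma topspace_test_topology: "topspace test_topology = test_space"
proof
  show "topspace test_topology \<subseteq> test_space"
    unfolding test_topology_def topology_generated_by_topspace by blast
  show "test_space \<subseteq> topspace test_topology"
  proof
    fix \<eta> assume \<eta>: "\<eta> \<in> test_space"
    have "test_seminorm 1 0 (\<lambda>x. \<eta> x - \<eta> x) < 1"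
      by (simp add: test_seminorm_def)
    with \<eta> have "\<eta> \<in> {\<phi> \<in> test_space. test_seminorm 1 0 (\<lambda>x. \<phi> x - \<eta> x) < 1}"
      by simp
    moreover have "(0::real) < 1" by simp
    ultimately show "\<eta> \<in> topspace test_topology"
      unfolding test_topology_def topology_generated_by_topspace using \<eta> by blast
  qed
qed

text \<open>A distribution is a function on all of \<open>real \<Rightarrow> complex\<close>, of which only the values
  on \<open>test_space\<close> matter; \<open>f \<phi>\<close> is the bilinear pairing of \<open>f\<close> with \<open>\<phi>\<close>.\<close>

definition test_dual :: "((real \<Rightarrow> complex) \<Rightarrow> complex) set" where
  "test_dual = {f.
     (\<forall>\<phi>\<in>test_space. \<forall>\<eta>\<in>test_space. f (\<lambda>x. \<phi> x + \<eta> x) = f \<phi> + f \<eta>) \<and>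
     (\<forall>c. \<forall>\<phi>\<in>test_space. f (\<lambda>x. c * \<phi> x) = c * f \<phi>) \<and>
     continuous_map test_topology euclidean f}"

definition dilate :: "real \<Rightarrow> ((real \<Rightarrow> complex) \<Rightarrow> complex) \<Rightarrow> (real \<Rightarrow> complex) \<Rightarrow> complex" where
  "dilate a f \<phi> = of_real (1 / a) * f (\<lambda>x. \<phi> (x / a))"

definition moment :: "((real \<Rightarrow> complex) \<Rightarrow> complex) \<Rightarrow> nat \<Rightarrow> complex" where
  "moment f \<alpha> = f (\<lambda>x. of_real x ^ \<alpha>)"

text \<open>The terms \<open>t n\<close> need not be multiples of the gauge functions \<open>s n\<close>: their coefficients may
  depend on the variable.\<close>

definition asymp_expansion ::
  "(real \<Rightarrow> complex) \<Rightarrow> (nat \<Rightarrow> real \<Rightarrow> complex) \<Rightarrow> (nat \<Rightarrow> real \<Rightarrow> real) \<Rightarrow> bool" where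
  "asymp_expansion F t s \<longleftrightarrow>
     (\<forall>N. (\<lambda>a. F a - (\<Sum>n\<le>N. t n a)) \<in> o[at_top](\<lambda>a. of_real (s N a)))"

end

theory Submission
  imports Defs
begin

text \<open>
  For \<open>a > 0\<close> the left-hand side is \<open>a powr (- 1 / 2)\<close> times the value of \<open>f\<close> at
  \<open>\<lambda>x. \<psi> ((x - b) / a)\<close>, and the partial sum up to \<open>N\<close> is the same multiple of the value of
  \<open>f\<close> at the Taylor polynomial of degree \<open>N\<close> of that function at \<open>x = 0\<close>: the polynomial has
  the coefficients \<open>iter_deriv k \<psi> (- b / a) / (a ^ k * fact k)\<close>, and \<open>f\<close> turns the monomials
  into moments. Hence the difference of the two is \<open>a powr (- 1 / 2) * f R\<close> with the Taylor
  remainder \<open>R\<close> (\<open>wavelet_transform_minus_partial_sum\<close>), and it suffices that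
  \<open>f R = O(1 / a ^ Suc N)\<close>.

  Since \<open>f\<close> is continuous and linear, it is bounded by a multiple of finitely many seminorms
  (\<open>test_dual_bound\<close>). So it suffices that each seminorm of \<open>R\<close> is \<open>O(1 / a ^ Suc N)\<close>
  (\<open>taylor_remainder_seminorm\<close>). A derivative of \<open>R\<close> of order \<open>n > N\<close> does not see the
  polynomial, and the chain rule gives it the factor \<open>1 / a ^ n\<close>; what remains is a derivative of
  \<open>\<psi>\<close>, which grows less than any exponential, uniformly in \<open>a \<ge> 1\<close>. The derivatives of order at
  most \<open>N\<close> vanish at \<open>0\<close>, so they are recovered from the one of order \<open>Suc N\<close> by repeated
  integration from \<open>0\<close>. This costs powers of \<open>\<bar>x\<bar>\<close>, which an exponential weight of arbitrarily
  small rate absorbs, but no power of \<open>a\<close>.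
\<close>

section \<open>Test functions through their derivatives\<close>

lemma iter_deriv_Suc: "iter_deriv (Suc n) g x = vector_derivative (iter_deriv n g) (at x)"
  by (simp add: iter_deriv_def)

lemma iter_deriv_0 [simp]: "iter_deriv 0 g = g"
  by (simp add: iter_deriv_def)

lemma smooth_iter_deriv:
  assumes "smooth g"
  shows "(iter_deriv n g has_vector_derivative iter_deriv (Suc n) g x) (at x)"
  using assms by (simp add: smooth_def iter_deriv_Suc vector_derivative_works)

text \<open>Derivatives of test functions are computed by writing down the whole sequence of
  candidates and differentiating each of them once. Taking \<open>iter_deriv\<close> step by step would need
  smoothness, which is what is to be shown, at each step.\<close>

lemma iter_deriv_tower:
  assumes tower: "\<And>n x. (G n has_vector_derivative G (Suc n) x) (at x)"
  shows "iter_deriv n (G 0) = G n"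
proof (induction n)
  case (Suc n)
  show ?case
    by (rule ext) (simp only: iter_deriv_Suc Suc.IH vector_derivative_at[OF tower])
qed simp

lemma smooth_tower:
  assumes tower: "\<And>n x. (G n has_vector_derivative G (Suc n) x) (at x)"
  shows "smooth (G 0)"
  unfolding smooth_def iter_deriv_tower[of G, OF tower]
  using tower by (blast intro: differentiableI_vector)

text \<open>A continuous function with a limit at infinity is bounded. Together with \<open>test_spaceI\<close>
  this replaces the limits in the definition of the test space by exponential bounds, which are
  easier to combine.\<close>

lemma test_space_growth:
  assumes "\<phi> \<in> test_space" "\<gamma> > 0"
  shows "\<exists>C>0. \<forall>x. norm (iter_deriv \<beta> \<phi> x) \<le> C * exp (\<gamma> * \<bar>x\<bar>)"
proof -
  define h where "h x = exp (- \<gamma> * \<bar>x\<bar>) *\<^sub>R iter_deriv \<beta> \<phi> x" for x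
  have sm: "smooth \<phi>" and lim: "(h \<longlongrightarrow> 0) at_infinity"
    using assms by (auto simp: test_space_def h_def[abs_def])
  have "continuous_on UNIV (iter_deriv \<beta> \<phi>)"
    using smooth_iter_deriv[OF sm]
    by (meson continuous_at_imp_continuous_on has_vector_derivative_continuous)
  then have cont: "continuous_on S h" for S
    unfolding h_def by (intro continuous_intros) (auto intro: continuous_on_subset)
  have "eventually (\<lambda>x. norm (h x) < 1) at_infinity"
    using lim[THEN tendstoD, of 1] by simp
  then obtain B where B: "\<And>x. norm x \<ge> B \<Longrightarrow> norm (h x) < 1"
    by (auto simp: eventually_at_infinity)
  have "bounded (h ` cball 0 B)"
    by (intro compact_imp_bounded compact_continuous_image cont compact_cball)
  then obtain D where D: "\<And>x. norm x \<le> B \<Longrightarrow> norm (h x) \<le> D"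
    unfolding bounded_iff by fastforce
  have bound: "norm (h x) \<le> max 1 D" for x
    using B[of x] D[of x] by linarith
  have "norm (iter_deriv \<beta> \<phi> x) \<le> max 1 D * exp (\<gamma> * \<bar>x\<bar>)" for x
    using bound[of x] by (simp add: h_def exp_minus field_simps)
  then show ?thesis
    by (intro exI[of _ "max 1 D"]) auto
qed

text \<open>A bound at half the rate forces the limit at the full rate.\<close>

lemma test_spaceI:
  assumes tower: "\<And>n x. (G n has_vector_derivative G (Suc n) x) (at x)"
    and growth: "\<And>\<gamma> \<beta>. \<gamma> > 0 \<Longrightarrow> \<exists>C. \<forall>x. norm (G \<beta> x) \<le> C * exp (\<gamma> * \<bar>x\<bar>)"
  shows "G 0 \<in> test_space"
proof -
  have "((\<lambda>x. exp (- \<gamma> * \<bar>x\<bar>) *\<^sub>R G \<beta> x) \<longlongrightarrow> 0) at_infinity" if \<gamma>: "\<gamma> > 0" for \<gamma> \<beta>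
  proof -
    obtain C where C: "\<And>x. norm (G \<beta> x) \<le> C * exp (\<gamma> / 2 * \<bar>x\<bar>)"
      using growth[OF half_gt_zero[OF \<gamma>]] by metis
    have *: "norm (exp (- \<gamma> * \<bar>x\<bar>) *\<^sub>R G \<beta> x) \<le> C * exp (- (\<gamma> / 2 * norm x))" for x
    proof -
      have "norm (exp (- \<gamma> * \<bar>x\<bar>) *\<^sub>R G \<beta> x) \<le> exp (- \<gamma> * \<bar>x\<bar>) * (C * exp (\<gamma> / 2 * \<bar>x\<bar>))"
        using C[of x] by simp
      also have "\<dots> = C * exp (- (\<gamma> / 2 * norm x))"
        by (simp add: mult.left_commute flip: exp_add)
      finally show ?thesis .
    qed
    have "((\<lambda>x::real. exp (- (\<gamma> / 2 * norm x))) \<longlongrightarrow> 0) at_infinity"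
    proof (rule filterlim_compose[OF exp_at_bot])
      show "filterlim (\<lambda>x::real. - (\<gamma> / 2 * norm x)) at_bot at_infinity"
        unfolding filterlim_uminus_at_bot minus_minus
        by (rule filterlim_tendsto_pos_mult_at_top[OF tendsto_const _ filterlim_norm_at_top])
           (use \<gamma> in simp)
    qed
    then have "((\<lambda>x::real. C * exp (- (\<gamma> / 2 * norm x))) \<longlongrightarrow> 0) at_infinity"
      by (rule tendsto_mult_right_zero)
    then show ?thesis
      by (rule Lim_null_comparison[OF always_eventually, rotated]) (use * in blast)
  qed
  then show ?thesis
    unfolding test_space_def using smooth_tower[of G, OF tower] iter_deriv_tower[of G, OF tower]
    by simp
qed

lemma
  assumes "\<phi> \<in> test_space" "\<eta> \<in> test_space"
  shows test_space_add_cmult: "(\<lambda>x. \<phi> x + c * \<eta> x) \<in> test_space" (is ?T)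
    and iter_deriv_add_cmult: "iter_deriv n (\<lambda>x. \<phi> x + c * \<eta> x)
           = (\<lambda>x. iter_deriv n \<phi> x + c * iter_deriv n \<eta> x)" (is ?D)
proof -
  define G where "G n x = iter_deriv n \<phi> x + c * iter_deriv n \<eta> x" for n x
  have sm: "smooth \<phi>" "smooth \<eta>"
    using assms by (auto simp: test_space_def)
  have tower: "(G n has_vector_derivative G (Suc n) x) (at x)" for n x
    unfolding G_def
    by (intro has_vector_derivative_add has_vector_derivative_mult_right smooth_iter_deriv sm)
  have growth: "\<exists>C. \<forall>x. norm (G \<beta> x) \<le> C * exp (\<gamma> * \<bar>x\<bar>)" if \<gamma>: "\<gamma> > 0" for \<gamma> \<beta>
  proof -
    obtain C D where C: "\<And>x. norm (iter_deriv \<beta> \<phi> x) \<le> C * exp (\<gamma> * \<bar>x\<bar>)"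
      and D: "\<And>x. norm (iter_deriv \<beta> \<eta> x) \<le> D * exp (\<gamma> * \<bar>x\<bar>)"
      using test_space_growth[OF assms(1) \<gamma>] test_space_growth[OF assms(2) \<gamma>] by metis
    have "norm (G \<beta> x) \<le> (C + norm c * D) * exp (\<gamma> * \<bar>x\<bar>)" for x
    proof -
      have "norm (G \<beta> x) \<le> norm (iter_deriv \<beta> \<phi> x) + norm c * norm (iter_deriv \<beta> \<eta> x)"
        unfolding G_def by (metis norm_triangle_ineq norm_mult)
      also have "\<dots> \<le> C * exp (\<gamma> * \<bar>x\<bar>) + norm c * (D * exp (\<gamma> * \<bar>x\<bar>))"
        by (intro add_mono mult_left_mono C D) auto
      finally show ?thesis by (simp add: algebra_simps)
    qed
    then show ?thesis by blast
  qed
  show ?T using test_spaceI[of G, OF tower growth] by (simp add: G_def[abs_def])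
  show ?D using iter_deriv_tower[of G n, OF tower] by (simp add: G_def[abs_def])
qed

lemma test_space_zero: "(\<lambda>x. 0) \<in> test_space"
  by (simp add: test_space_def smooth_def)

lemma test_space_cmult: "\<phi> \<in> test_space \<Longrightarrow> (\<lambda>x. c * \<phi> x) \<in> test_space"
  using test_space_add_cmult[OF test_space_zero, of \<phi> c] by simp

lemma test_space_sum:
  assumes "\<And>k. k \<in> A \<Longrightarrow> \<phi> k \<in> test_space"
  shows "(\<lambda>x. \<Sum>k\<in>A. \<phi> k x) \<in> test_space"
  using assms
proof (induction A rule: infinite_finite_induct)
  case (insert k A)
  then show ?case using test_space_add_cmult[of "\<lambda>x. \<Sum>k\<in>A. \<phi> k x" "\<phi> k" 1] by (simp add: add.commute)
qed (simp_all add: test_space_zero)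

lemma iter_deriv_cmult:
  "\<phi> \<in> test_space \<Longrightarrow> iter_deriv n (\<lambda>x. c * \<phi> x) = (\<lambda>x. c * iter_deriv n \<phi> x)"
  using iter_deriv_add_cmult[OF test_space_zero, of \<phi> n c] by simp

lemma iter_deriv_sum:
  assumes "\<And>k. k \<in> A \<Longrightarrow> \<phi> k \<in> test_space"
  shows "iter_deriv n (\<lambda>x. \<Sum>k\<in>A. \<phi> k x) = (\<lambda>x. \<Sum>k\<in>A. iter_deriv n (\<phi> k) x)"
  using assms
proof (induction A rule: infinite_finite_induct)
  case (insert k A)
  then show ?case
    using iter_deriv_add_cmult[of "\<lambda>x. \<Sum>k\<in>A. \<phi> k x" "\<phi> k" n 1]
    by (simp add: add.commute test_space_sum)
qed simp_all

lemma power_le_exp: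
  fixes t :: real
  assumes "t \<ge> 0"
  shows "t ^ m \<le> fact m * exp t"
proof -
  have "(\<Sum>n\<in>{m}. t ^ n /\<^sub>R fact n) \<le> exp t"
    unfolding exp_def by (rule sum_le_suminf) (use assms summable_exp_generic[of t] in auto)
  then show ?thesis by (simp add: field_simps)
qed

lemma power_le_exp_scaled:
  fixes x \<delta> :: real
  assumes "\<delta> > 0"
  shows "\<bar>x\<bar> ^ m \<le> fact m / \<delta> ^ m * exp (\<delta> * \<bar>x\<bar>)"
  using power_le_exp[of "\<delta> * \<bar>x\<bar>" m] assms by (simp add: field_simps power_mult_distrib)

section \<open>Monomials and affine substitutions\<close>

text \<open>The derivative of order \<open>n\<close> of the divided power \<open>x ^ k / fact k\<close>. With the factorial
  included, differentiation only lowers the exponent, and the value at \<open>0\<close> is \<open>1\<close> if \<open>n = k\<close> and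
  \<open>0\<close> otherwise.\<close>

definition divided_power_deriv :: "nat \<Rightarrow> nat \<Rightarrow> real \<Rightarrow> complex" where
  "divided_power_deriv k n x = (if n \<le> k then of_real (x ^ (k - n) / fact (k - n)) else 0)"

lemma divided_power_deriv_tower:
  "(divided_power_deriv k n has_vector_derivative divided_power_deriv k (Suc n) x) (at x)"
proof (cases "n < k")
  case True
  define j where "j = k - Suc n"
  have kn: "k - n = Suc j" "k - Suc n = j" using True by (auto simp: j_def)
  have "((\<lambda>x::real. x ^ Suc j / fact (Suc j)) has_real_derivative x ^ j / fact j) (at x)"
    by (rule derivative_eq_intros refl | simp)+
  then have "((\<lambda>x. complex_of_real (x ^ Suc j / fact (Suc j))) has_vector_derivative
      of_real (x ^ j / fact j)) (at x)"
    by (intro has_vector_derivative_of_real)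
       (simp only: has_real_derivative_iff_has_vector_derivative)
  moreover have "divided_power_deriv k n = (\<lambda>x. of_real (x ^ Suc j / fact (Suc j)))"
    "divided_power_deriv k (Suc n) x = of_real (x ^ j / fact j)"
    using True unfolding divided_power_deriv_def kn by simp_all
  ultimately show ?thesis by simp
next
  case False
  then show ?thesis
    by (cases "n = k") (simp_all add: divided_power_deriv_def[abs_def])
qed

lemma
  shows test_space_power: "(\<lambda>x. of_real (x ^ k / fact k)) \<in> test_space"
    and iter_deriv_power: "iter_deriv n (\<lambda>x. of_real (x ^ k / fact k)) = divided_power_deriv k n"
proof -
  have *: "divided_power_deriv k 0 = (\<lambda>x. of_real (x ^ k / fact k))"
    by (simp add: divided_power_deriv_def[abs_def])
  have growth: "\<exists>C. \<forall>x. norm (divided_power_deriv k \<beta> x) \<le> C * exp (\<gamma> * \<bar>x\<bar>)" if \<gamma>: "\<gamma> > 0" for \<gamma> \<beta>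
  proof (intro exI allI)
    fix x
    show "norm (divided_power_deriv k \<beta> x) \<le> 1 / \<gamma> ^ (k - \<beta>) * exp (\<gamma> * \<bar>x\<bar>)"
      using power_le_exp_scaled[OF \<gamma>, of x "k - \<beta>"] \<gamma>
      by (simp add: divided_power_deriv_def norm_divide norm_power field_simps)
  qed
  show "(\<lambda>x. of_real (x ^ k / fact k)) \<in> test_space"
    using test_spaceI[of "divided_power_deriv k", OF divided_power_deriv_tower growth] by (simp add: *)
  show "iter_deriv n (\<lambda>x. of_real (x ^ k / fact k)) = divided_power_deriv k n"
    using iter_deriv_tower[of "divided_power_deriv k", OF divided_power_deriv_tower] by (simp add: *)
qed

text \<open>For \<open>a \<ge> 1\<close> the argument satisfies \<open>\<bar>(x - b) / a\<bar> \<le> \<bar>b\<bar> + \<bar>x\<bar>\<close>, so the bound is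
  independent of the scale \<open>a\<close>. This makes the remainder estimate uniform in \<open>a\<close>.\<close>

lemma growth_affine:
  fixes a b x :: real
  assumes "\<And>y. norm (g y) \<le> C * exp (\<delta> * \<bar>y\<bar>)" "C \<ge> 0" "\<delta> \<ge> 0" "a \<ge> 1"
  shows "norm (g ((x - b) / a)) \<le> C * exp (\<delta> * \<bar>b\<bar>) * exp (\<delta> * \<bar>x\<bar>)"
proof -
  have "\<bar>(x - b) / a\<bar> \<le> \<bar>x - b\<bar>"
    using assms(4) by (simp add: divide_le_eq mult_left_mono[of 1 a "\<bar>x - b\<bar>", simplified])
  also have "\<dots> \<le> \<bar>b\<bar> + \<bar>x\<bar>" by simp
  finally have "\<delta> * \<bar>(x - b) / a\<bar> \<le> \<delta> * \<bar>b\<bar> + \<delta> * \<bar>x\<bar>"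
    using assms(3) by (metis mult_left_mono distrib_left)
  then have "C * exp (\<delta> * \<bar>(x - b) / a\<bar>) \<le> C * exp (\<delta> * \<bar>b\<bar> + \<delta> * \<bar>x\<bar>)"
    using assms(2) by (intro mult_left_mono) auto
  then show ?thesis using assms(1)[of "(x - b) / a"] by (simp add: exp_add)
qed

lemma
  assumes "\<phi> \<in> test_space" "a \<ge> 1"
  shows test_space_affine: "(\<lambda>x. \<phi> ((x - b) / a)) \<in> test_space" (is ?T)
    and iter_deriv_affine: "iter_deriv n (\<lambda>x. \<phi> ((x - b) / a))
           = (\<lambda>x. iter_deriv n \<phi> ((x - b) / a) / of_real (a ^ n))" (is ?D)
proof -
  define G where "G n x = iter_deriv n \<phi> ((x - b) / a) / of_real (a ^ n)" for n x
  have sm: "smooth \<phi>" using assms by (auto simp: test_space_def)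
  have tower: "(G n has_vector_derivative G (Suc n) x) (at x)" for n x
  proof -
    have "((\<lambda>x. (x - b) / a) has_vector_derivative 1 / a) (at x)"
      unfolding has_real_derivative_iff_has_vector_derivative[symmetric]
      using assms by (auto intro!: derivative_eq_intros)
    from vector_diff_chain_at[OF this smooth_iter_deriv[OF sm, of n]]
    have "((\<lambda>x. iter_deriv n \<phi> ((x - b) / a)) has_vector_derivative
             (1 / a) *\<^sub>R iter_deriv (Suc n) \<phi> ((x - b) / a)) (at x)"
      by (simp add: o_def)
    from has_vector_derivative_mult_left[OF this, of "1 / of_real (a ^ n)"]
    show ?thesis
      by (simp add: G_def[abs_def] scaleR_conv_of_real)
  qed
  have growth: "\<exists>C. \<forall>x. norm (G \<beta> x) \<le> C * exp (\<gamma> * \<bar>x\<bar>)" if \<gamma>: "\<gamma> > 0" for \<gamma> \<beta>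
  proof -
    obtain C where C: "C > 0" "\<And>x. norm (iter_deriv \<beta> \<phi> x) \<le> C * exp (\<gamma> * \<bar>x\<bar>)"
      using test_space_growth[OF assms(1) \<gamma>] by metis
    have "norm (G \<beta> x) \<le> C * exp (\<gamma> * \<bar>b\<bar>) * exp (\<gamma> * \<bar>x\<bar>)" for x
    proof -
      have "norm (G \<beta> x) \<le> norm (iter_deriv \<beta> \<phi> ((x - b) / a))"
        using assms(2) by (simp add: G_def norm_divide norm_power divide_le_eq
                mult_left_mono[of 1 _ "norm _", simplified])
      also have "\<dots> \<le> C * exp (\<gamma> * \<bar>b\<bar>) * exp (\<gamma> * \<bar>x\<bar>)"
        by (rule growth_affine) (use C \<gamma> assms in auto)
      finally show ?thesis .
    qed
    then show ?thesis by blast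
  qed
  show ?T using test_spaceI[of G, OF tower growth] by (simp add: G_def[abs_def])
  show ?D using iter_deriv_tower[of G n, OF tower] by (simp add: G_def[abs_def])
qed

section \<open>Seminorms and the bound for continuous functionals\<close>

lemma weighted_deriv_le_seminorm:
  assumes "\<phi> \<in> test_space" "\<gamma> > 0"
  shows "norm (exp (- \<gamma> * \<bar>x\<bar>) *\<^sub>R iter_deriv \<beta> \<phi> x) \<le> test_seminorm \<gamma> \<beta> \<phi>"
proof -
  obtain C where "\<And>x. norm (iter_deriv \<beta> \<phi> x) \<le> C * exp (\<gamma> * \<bar>x\<bar>)"
    using test_space_growth[OF assms] by metis
  then have "norm (exp (- \<gamma> * \<bar>x\<bar>) *\<^sub>R iter_deriv \<beta> \<phi> x) \<le> C" for x
    by (simp add: exp_minus field_simps)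
  then have "bdd_above (range (\<lambda>x. norm (exp (- \<gamma> * \<bar>x\<bar>) *\<^sub>R iter_deriv \<beta> \<phi> x)))"
    by (auto simp: bdd_above_def)
  then show ?thesis unfolding test_seminorm_def by (rule cSUP_upper[OF UNIV_I])
qed

lemma test_seminorm_leI:
  assumes "\<And>x. norm (iter_deriv \<beta> \<phi> x) \<le> C * exp (\<gamma> * \<bar>x\<bar>)"
  shows "test_seminorm \<gamma> \<beta> \<phi> \<le> C"
  unfolding test_seminorm_def
proof (rule cSUP_least)
  fix x show "norm (exp (- \<gamma> * \<bar>x\<bar>) *\<^sub>R iter_deriv \<beta> \<phi> x) \<le> C"
    using assms[of x] by (simp add: exp_minus field_simps)
qed simp

lemma test_seminorm_add_cmult:
  assumes "\<phi> \<in> test_space" "\<eta> \<in> test_space" "\<gamma> > 0"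
  shows "test_seminorm \<gamma> \<beta> (\<lambda>x. \<phi> x + c * \<eta> x)
           \<le> test_seminorm \<gamma> \<beta> \<phi> + norm c * test_seminorm \<gamma> \<beta> \<eta>"
proof -
  have D: "iter_deriv \<beta> (\<lambda>x. \<phi> x + c * \<eta> x) = (\<lambda>x. iter_deriv \<beta> \<phi> x + c * iter_deriv \<beta> \<eta> x)"
    by (rule iter_deriv_add_cmult[OF assms(1,2)])
  have "norm (exp (- \<gamma> * \<bar>x\<bar>) *\<^sub>R (iter_deriv \<beta> \<phi> x + c * iter_deriv \<beta> \<eta> x))
          \<le> test_seminorm \<gamma> \<beta> \<phi> + norm c * test_seminorm \<gamma> \<beta> \<eta>" for x
  proof -
    let ?e = "exp (- \<gamma> * \<bar>x\<bar>)"
    have "norm (?e *\<^sub>R (iter_deriv \<beta> \<phi> x + c * iter_deriv \<beta> \<eta> x))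
        = norm (?e *\<^sub>R iter_deriv \<beta> \<phi> x + c * (?e *\<^sub>R iter_deriv \<beta> \<eta> x))"
      by (simp add: algebra_simps)
    also have "\<dots> \<le> norm (?e *\<^sub>R iter_deriv \<beta> \<phi> x) + norm c * norm (?e *\<^sub>R iter_deriv \<beta> \<eta> x)"
      by (metis norm_triangle_ineq norm_mult)
    also have "\<dots> \<le> test_seminorm \<gamma> \<beta> \<phi> + norm c * test_seminorm \<gamma> \<beta> \<eta>"
      by (intro add_mono mult_left_mono weighted_deriv_le_seminorm assms) auto
    finally show ?thesis .
  qed
  then show ?thesis
    unfolding test_seminorm_def D by (intro cSUP_least) (auto simp: test_seminorm_def)
qed

lemma test_seminorm_zero: "test_seminorm \<gamma> \<beta> (\<lambda>x. 0) = 0"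
  by (simp add: test_seminorm_def)

lemma test_seminorm_cmult:
  assumes "\<phi> \<in> test_space" "\<gamma> > 0"
  shows "test_seminorm \<gamma> \<beta> (\<lambda>x. c * \<phi> x) \<le> norm c * test_seminorm \<gamma> \<beta> \<phi>"
  using test_seminorm_add_cmult[OF test_space_zero assms, of \<beta> c] by (simp add: test_seminorm_zero)

text \<open>The subbase of the topology consists of balls with arbitrary centres \<open>\<eta>\<close>. By the triangle
  inequality, a ball that contains \<open>0\<close> contains a smaller ball of the same seminorm centred at
  \<open>0\<close>, so finite intersections and unions reduce to balls centred at \<open>0\<close>.\<close>

lemma test_topology_zero_neighbourhood:
  assumes "openin test_topology U" "(\<lambda>x. 0) \<in> U"
  shows "\<exists>S \<epsilon>. finite S \<and> (\<forall>(\<gamma>, \<beta>)\<in>S. \<gamma> > 0) \<and> \<epsilon> > 0 \<and>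
     (\<forall>\<phi>\<in>test_space. (\<forall>(\<gamma>, \<beta>)\<in>S. test_seminorm \<gamma> \<beta> \<phi> < \<epsilon>) \<longrightarrow> \<phi> \<in> U)"
proof -
  let ?B = "{{\<phi> \<in> test_space. test_seminorm \<gamma> \<beta> (\<lambda>x. \<phi> x - \<eta> x) < r} | \<eta> \<gamma> \<beta> r.
        \<eta> \<in> test_space \<and> 0 < \<gamma> \<and> 0 < r}"
  have "generate_topology_on ?B U"
    using assms(1) by (simp add: test_topology_def openin_topology_generated_by_iff)
  then show ?thesis using assms(2)
  proof (induction rule: generate_topology_on.induct)
    case Empty
    then show ?case by simp
  next
    case (Int a b)
    from Int.IH(1) Int.prems obtain S \<epsilon> where S: "finite S" "\<forall>(\<gamma>, \<beta>)\<in>S. \<gamma> > 0" "\<epsilon> > 0"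
      "\<And>\<phi>. \<phi> \<in> test_space \<Longrightarrow> \<forall>(\<gamma>, \<beta>)\<in>S. test_seminorm \<gamma> \<beta> \<phi> < \<epsilon> \<Longrightarrow> \<phi> \<in> a" by blast
    from Int.IH(2) Int.prems obtain T \<delta> where T: "finite T" "\<forall>(\<gamma>, \<beta>)\<in>T. \<gamma> > 0" "\<delta> > 0"
      "\<And>\<phi>. \<phi> \<in> test_space \<Longrightarrow> \<forall>(\<gamma>, \<beta>)\<in>T. test_seminorm \<gamma> \<beta> \<phi> < \<delta> \<Longrightarrow> \<phi> \<in> b" by blast
    have "\<phi> \<in> a \<inter> b"
      if "\<phi> \<in> test_space" "\<forall>(\<gamma>, \<beta>)\<in>S \<union> T. test_seminorm \<gamma> \<beta> \<phi> < min \<epsilon> \<delta>" for \<phi>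
      using that by (intro IntI S(4) T(4)) auto
    moreover have "finite (S \<union> T)" "\<forall>(\<gamma>, \<beta>)\<in>S \<union> T. \<gamma> > 0" "min \<epsilon> \<delta> > 0"
      using S T by auto
    ultimately show ?case by blast
  next
    case (UN K)
    then obtain k where k: "k \<in> K" "(\<lambda>x. 0) \<in> k" by blast
    from UN.IH[OF k] obtain S \<epsilon> where S: "finite S" "\<forall>(\<gamma>, \<beta>)\<in>S. \<gamma> > 0" "\<epsilon> > 0"
      "\<forall>\<phi>\<in>test_space. (\<forall>(\<gamma>, \<beta>)\<in>S. test_seminorm \<gamma> \<beta> \<phi> < \<epsilon>) \<longrightarrow> \<phi> \<in> k"
      by (elim exE conjE)
    have "\<phi> \<in> \<Union>K"
      if "\<phi> \<in> test_space" "\<forall>(\<gamma>, \<beta>)\<in>S. test_seminorm \<gamma> \<beta> \<phi> < \<epsilon>" for \<phi>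
      using S(4) that k(1) by blast
    with S(1-3) show ?case by blast
  next
    case (Basis s)
    then obtain \<eta> \<gamma> \<beta> r where s: "s = {\<phi> \<in> test_space. test_seminorm \<gamma> \<beta> (\<lambda>x. \<phi> x - \<eta> x) < r}"
      and \<eta>: "\<eta> \<in> test_space" "0 < \<gamma>" "0 < r" by blast
    have neg: "(\<lambda>x. - \<eta> x) \<in> test_space"
      using test_space_cmult[OF \<eta>(1), of "-1"] by simp
    define \<epsilon> where "\<epsilon> = r - test_seminorm \<gamma> \<beta> (\<lambda>x. - \<eta> x)"
    have "\<epsilon> > 0" using Basis.prems by (simp add: s \<epsilon>_def)
    moreover have "\<phi> \<in> s" if "\<phi> \<in> test_space" "test_seminorm \<gamma> \<beta> \<phi> < \<epsilon>" for \<phi>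
      using test_seminorm_add_cmult[OF that(1) neg \<eta>(2), of \<beta> 1] that by (simp add: s \<epsilon>_def)
    ultimately show ?case
      using \<eta> by (intro exI[of _ "{(\<gamma>, \<beta>)}"] exI[of _ \<epsilon>]) auto
  qed
qed

lemma test_dual_add:
  "f \<in> test_dual \<Longrightarrow> \<phi> \<in> test_space \<Longrightarrow> \<eta> \<in> test_space \<Longrightarrow> f (\<lambda>x. \<phi> x + \<eta> x) = f \<phi> + f \<eta>"
  by (simp add: test_dual_def)

lemma test_dual_cmult:
  "f \<in> test_dual \<Longrightarrow> \<phi> \<in> test_space \<Longrightarrow> f (\<lambda>x. c * \<phi> x) = c * f \<phi>"
  by (simp add: test_dual_def)

lemma test_dual_zero: "f \<in> test_dual \<Longrightarrow> f (\<lambda>x. 0) = 0"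
  using test_dual_cmult[OF _ test_space_zero, of f 0] by simp

lemma test_dual_sum:
  assumes "f \<in> test_dual" "\<And>k. k \<in> A \<Longrightarrow> \<phi> k \<in> test_space"
  shows "f (\<lambda>x. \<Sum>k\<in>A. \<phi> k x) = (\<Sum>k\<in>A. f (\<phi> k))"
  using assms(2)
proof (induction A rule: infinite_finite_induct)
  case (insert k A)
  then show ?case by (simp add: test_dual_add[OF assms(1)] test_space_sum)
qed (simp_all add: test_dual_zero[OF assms(1)])

text \<open>The usual scaling argument: \<open>norm (f \<phi>) < 1\<close> holds on some neighbourhood of \<open>0\<close>, and a
  multiple of any given \<open>\<phi>\<close> lies in it. The number \<open>K\<close> is required to be positive because the
  multiple is taken by a factor proportional to \<open>1 / K\<close>.\<close>

lemma test_dual_bound: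
  assumes f: "f \<in> test_dual"
  shows "\<exists>S C. finite S \<and> (\<forall>(\<gamma>, \<beta>)\<in>S. \<gamma> > 0) \<and> C > 0 \<and>
     (\<forall>\<phi>\<in>test_space. \<forall>K>0. (\<forall>(\<gamma>, \<beta>)\<in>S. test_seminorm \<gamma> \<beta> \<phi> \<le> K) \<longrightarrow> norm (f \<phi>) \<le> C * K)"
proof -
  define U where "U = {\<phi> \<in> topspace test_topology. f \<phi> \<in> ball 0 1}"
  have "continuous_map test_topology euclidean f"
    using f by (simp add: test_dual_def)
  then have "openin test_topology U"
    unfolding U_def by (rule openin_continuous_map_preimage) simp
  moreover have "(\<lambda>x. 0) \<in> U"
    by (simp add: U_def topspace_test_topology test_space_zero test_dual_zero[OF f])
  ultimately obtain S \<epsilon> where S: "finite S" "\<forall>(\<gamma>, \<beta>)\<in>S. \<gamma> > 0" "\<epsilon> > 0"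
    and nb: "\<And>\<phi>. \<phi> \<in> test_space \<Longrightarrow> \<forall>(\<gamma>, \<beta>)\<in>S. test_seminorm \<gamma> \<beta> \<phi> < \<epsilon> \<Longrightarrow> \<phi> \<in> U"
    using test_topology_zero_neighbourhood by meson
  have "norm (f \<phi>) \<le> 2 / \<epsilon> * K"
    if \<phi>: "\<phi> \<in> test_space" and K: "K > 0" and le: "\<forall>(\<gamma>, \<beta>)\<in>S. test_seminorm \<gamma> \<beta> \<phi> \<le> K" for \<phi> K
  proof -
    \<comment> \<open>The factor 2 makes the seminorms of the multiple strictly smaller than \<open>\<epsilon>\<close>.\<close>
    define c where "c = \<epsilon> / (2 * K)"
    have c: "c > 0" using S K by (simp add: c_def)
    have "test_seminorm \<gamma> \<beta> (\<lambda>x. of_real c * \<phi> x) < \<epsilon>" if "(\<gamma>, \<beta>) \<in> S" for \<gamma> \<beta>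
    proof -
      have "test_seminorm \<gamma> \<beta> (\<lambda>x. of_real c * \<phi> x) \<le> c * test_seminorm \<gamma> \<beta> \<phi>"
        using test_seminorm_cmult[OF \<phi>, of \<gamma> \<beta> "of_real c"] S(2) that c by auto
      also have "\<dots> \<le> c * K"
        using le that c by (intro mult_left_mono) auto
      also have "\<dots> < \<epsilon>" using K S(3) by (simp add: c_def)
      finally show ?thesis .
    qed
    then have "(\<lambda>x. of_real c * \<phi> x) \<in> U"
      by (intro nb test_space_cmult \<phi>) auto
    then have "c * norm (f \<phi>) < 1"
      using c by (simp add: U_def test_dual_cmult[OF f \<phi>] norm_mult)
    then show ?thesis using K S(3) by (simp add: c_def field_simps)
  qed
  then show ?thesis
    using S by (intro exI[of _ S] exI[of _ "2 / \<epsilon>"]) auto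
qed

section \<open>Integrating growth bounds\<close>

text \<open>The bound on \<open>g'\<close> increases with \<open>\<bar>x\<bar>\<close>, so on the interval between \<open>0\<close> and \<open>x\<close> it is
  largest at \<open>x\<close>, and the mean value inequality contributes one more factor \<open>\<bar>x\<bar>\<close>.\<close>

lemma integrate_growth_bound:
  fixes g g' :: "real \<Rightarrow> complex"
  assumes der: "\<And>x. (g has_vector_derivative g' x) (at x)" and "g 0 = 0"
    and bound: "\<And>x. norm (g' x) \<le> M * \<bar>x\<bar> ^ m * exp (\<delta> * \<bar>x\<bar>)" and "M \<ge> 0" "\<delta> \<ge> 0"
  shows "norm (g x) \<le> M * \<bar>x\<bar> ^ Suc m * exp (\<delta> * \<bar>x\<bar>)"
proof -
  have "norm (g x - g 0) \<le> (M * \<bar>x\<bar> ^ m * exp (\<delta> * \<bar>x\<bar>)) * norm (x - 0)"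
  proof (rule differentiable_bound[where S = "cball 0 \<bar>x\<bar>"])
    fix y :: real assume "y \<in> cball 0 \<bar>x\<bar>"
    then have y: "\<bar>y\<bar> \<le> \<bar>x\<bar>" by simp
    show "(g has_derivative (\<lambda>h. h *\<^sub>R g' y)) (at y within cball 0 \<bar>x\<bar>)"
      using has_vector_derivative_at_within[OF der] by (simp add: has_vector_derivative_def)
    have "M * \<bar>y\<bar> ^ m * exp (\<delta> * \<bar>y\<bar>) \<le> M * \<bar>x\<bar> ^ m * exp (\<delta> * \<bar>x\<bar>)"
      using y assms(4,5) by (intro mult_mono power_mono) (auto intro: mult_left_mono)
    with bound[of y] have le: "norm (g' y) \<le> M * \<bar>x\<bar> ^ m * exp (\<delta> * \<bar>x\<bar>)"
      by linarith
    show "onorm (\<lambda>h. h *\<^sub>R g' y) \<le> M * \<bar>x\<bar> ^ m * exp (\<delta> * \<bar>x\<bar>)"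
      using mult_right_mono[OF le] by (intro onorm_le) (simp add: mult.commute)
  qed simp_all
  then show ?thesis using assms(2) by (simp add: mult_ac)
qed

text \<open>A form of Taylor's theorem that needs neither an explicit remainder nor a mean value
  theorem for complex values: all derivatives below order \<open>m\<close> vanish at \<open>0\<close>, so a bound on
  the one of order \<open>m\<close> can be integrated \<open>j\<close> times.\<close>

lemma flat_growth_bound:
  assumes tower: "\<And>n x. (G n has_vector_derivative G (Suc n) x) (at x)"
    and flat: "\<And>n. n < m \<Longrightarrow> G n 0 = (0::complex)"
    and top: "\<And>x. norm (G m x) \<le> M * exp (\<delta> * \<bar>x\<bar>)" and "M \<ge> 0" "\<delta> \<ge> 0"
  shows "j \<le> m \<Longrightarrow> norm (G (m - j) x) \<le> M * \<bar>x\<bar> ^ j * exp (\<delta> * \<bar>x\<bar>)"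
proof (induction j arbitrary: x)
  case 0
  then show ?case using top by simp
next
  case (Suc j)
  have "Suc (m - Suc j) = m - j" using Suc.prems by simp
  then show ?case
    using tower[of "m - Suc j"] Suc flat[of "m - Suc j"] assms(4,5)
    by (intro integrate_growth_bound[where g' = "G (m - j)"]) auto
qed

section \<open>The Taylor remainder of the dilated wavelet\<close>

text \<open>The expansion is taken in \<open>x\<close> at \<open>0\<close>, where the dilated and translated function
  \<open>\<lambda>x. \<psi> ((x - b) / a)\<close> has the derivatives \<open>iter_deriv k \<psi> (- b / a) / a ^ k\<close>.\<close>

definition taylor_remainder ::
  "(real \<Rightarrow> complex) \<Rightarrow> real \<Rightarrow> nat \<Rightarrow> real \<Rightarrow> real \<Rightarrow> complex" where
  "taylor_remainder \<psi> b N a x = \<psi> ((x - b) / a) -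
     (\<Sum>k\<le>N. iter_deriv k \<psi> (- b / a) / of_real (a ^ k) * of_real (x ^ k / fact k))"

lemma
  assumes "\<psi> \<in> test_space" "a \<ge> 1"
  shows taylor_remainder_test_space: "taylor_remainder \<psi> b N a \<in> test_space"
    and iter_deriv_taylor_remainder: "iter_deriv n (taylor_remainder \<psi> b N a) x =
      iter_deriv n \<psi> ((x - b) / a) / of_real (a ^ n) -
      (\<Sum>k\<le>N. iter_deriv k \<psi> (- b / a) / of_real (a ^ k) * divided_power_deriv k n x)"
proof -
  let ?p = "\<lambda>k x. iter_deriv k \<psi> (- b / a) / of_real (a ^ k) * of_real (x ^ k / fact k)"
  have R: "taylor_remainder \<psi> b N a = (\<lambda>x. \<psi> ((x - b) / a) + (-1) * (\<Sum>k\<le>N. ?p k x))"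
    by (simp add: taylor_remainder_def[abs_def])
  have p: "?p k \<in> test_space" for k
    by (rule test_space_cmult[OF test_space_power])
  have P: "(\<lambda>x. \<Sum>k\<le>N. ?p k x) \<in> test_space"
    by (rule test_space_sum[OF p])
  note A = test_space_affine[OF assms, of b]
  show "taylor_remainder \<psi> b N a \<in> test_space"
    unfolding R by (rule test_space_add_cmult[OF A P])
  show "iter_deriv n (taylor_remainder \<psi> b N a) x =
      iter_deriv n \<psi> ((x - b) / a) / of_real (a ^ n) -
      (\<Sum>k\<le>N. iter_deriv k \<psi> (- b / a) / of_real (a ^ k) * divided_power_deriv k n x)"
    unfolding R iter_deriv_add_cmult[OF A P] iter_deriv_affine[OF assms]
      iter_deriv_sum[of "{..N}" ?p n, OF p] iter_deriv_cmult[OF test_space_power] iter_deriv_power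
    by simp
qed

lemma iter_deriv_taylor_remainder_at_0:
  assumes "\<psi> \<in> test_space" "a \<ge> 1" "n \<le> N"
  shows "iter_deriv n (taylor_remainder \<psi> b N a) 0 = 0"
proof -
  have d: "divided_power_deriv k n 0 = (if k = n then 1 else 0)" for k
    by (auto simp: divided_power_deriv_def)
  show ?thesis
    unfolding iter_deriv_taylor_remainder[OF assms(1,2)] d
    using assms(3) by (simp add: if_distrib cong: if_cong)
qed

text \<open>Every order \<open>\<beta>\<close>, small or large, gives the same power of \<open>a\<close>:
  for \<open>\<beta> > N\<close> it comes from the chain rule, for \<open>\<beta> \<le> N\<close> it is inherited from order \<open>Suc N\<close>
  by integration.\<close>

lemma taylor_remainder_seminorm:
  assumes \<psi>: "\<psi> \<in> test_space" and \<gamma>: "\<gamma> > 0"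
  shows "\<exists>K>0. \<forall>a\<ge>1. test_seminorm \<gamma> \<beta> (taylor_remainder \<psi> b N a) \<le> K / a ^ Suc N"
proof -
  have high: "\<exists>C>0. \<forall>a\<ge>1. \<forall>x. norm (iter_deriv n (taylor_remainder \<psi> b N a) x)
                 \<le> C / a ^ Suc N * exp (\<delta> * \<bar>x\<bar>)" if n: "n > N" and \<delta>: "\<delta> > 0" for n \<delta>
  proof -
    obtain C where C: "C > 0" "\<And>x. norm (iter_deriv n \<psi> x) \<le> C * exp (\<delta> * \<bar>x\<bar>)"
      using test_space_growth[OF \<psi> \<delta>] by metis
    have "norm (iter_deriv n (taylor_remainder \<psi> b N a) x)
            \<le> C * exp (\<delta> * \<bar>b\<bar>) / a ^ Suc N * exp (\<delta> * \<bar>x\<bar>)" if a: "a \<ge> 1" for a x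
    proof -
      have "iter_deriv n (taylor_remainder \<psi> b N a) x
          = iter_deriv n \<psi> ((x - b) / a) / of_real (a ^ n)"
        using n by (simp add: iter_deriv_taylor_remainder[OF \<psi> a] divided_power_deriv_def)
      then have "norm (iter_deriv n (taylor_remainder \<psi> b N a) x)
          = norm (iter_deriv n \<psi> ((x - b) / a)) / a ^ n"
        using a by (simp add: norm_divide norm_power)
      also have "\<dots> \<le> (C * exp (\<delta> * \<bar>b\<bar>) * exp (\<delta> * \<bar>x\<bar>)) / a ^ Suc N"
        using growth_affine[of "iter_deriv n \<psi>" C \<delta> a x b] C \<delta> a n
        by (intro frac_le power_increasing) (auto simp del: power_Suc)
      finally show ?thesis by simp
    qed
    then show ?thesis
      using C by (intro exI[of _ "C * exp (\<delta> * \<bar>b\<bar>)"]) auto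
  qed
  show ?thesis
  proof (cases "\<beta> > N")
    case True
    then show ?thesis using high[OF True \<gamma>] test_seminorm_leI by meson
  next
    case False
    define j where "j = Suc N - \<beta>"
    have j: "j \<le> Suc N" "Suc N - j = \<beta>" using False by (auto simp: j_def)
    \<comment> \<open>Half of the rate bounds the derivative of order \<open>Suc N\<close>, the other half absorbs \<open>\<bar>x\<bar> ^ j\<close>.\<close>
    define \<delta> where "\<delta> = \<gamma> / 2"
    have \<delta>: "\<delta> > 0" using \<gamma> by (simp add: \<delta>_def)
    obtain M where M: "M > 0" and top: "\<And>a x. a \<ge> 1 \<Longrightarrow>
        norm (iter_deriv (Suc N) (taylor_remainder \<psi> b N a) x) \<le> M / a ^ Suc N * exp (\<delta> * \<bar>x\<bar>)"
      using high[of "Suc N", OF _ \<delta>] by blast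
    define K where "K = M * (fact j / \<delta> ^ j)"
    have "test_seminorm \<gamma> \<beta> (taylor_remainder \<psi> b N a) \<le> K / a ^ Suc N" if a: "a \<ge> 1" for a
    proof (rule test_seminorm_leI)
      fix x
      let ?R = "taylor_remainder \<psi> b N a"
      have "smooth ?R"
        using taylor_remainder_test_space[OF \<psi> a] by (simp add: test_space_def)
      then have "norm (iter_deriv (Suc N - j) ?R x) \<le> M / a ^ Suc N * \<bar>x\<bar> ^ j * exp (\<delta> * \<bar>x\<bar>)"
        using M \<delta> a j(1)
        by (intro flat_growth_bound smooth_iter_deriv top iter_deriv_taylor_remainder_at_0 \<psi>) auto
      also have "\<dots> \<le> M / a ^ Suc N * (fact j / \<delta> ^ j * exp (\<delta> * \<bar>x\<bar>)) * exp (\<delta> * \<bar>x\<bar>)"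
        using M a by (intro mult_right_mono mult_left_mono power_le_exp_scaled \<delta>) auto
      also have "\<dots> = K / a ^ Suc N * exp (\<gamma> * \<bar>x\<bar>)"
        by (simp add: K_def \<delta>_def mult_exp_exp flip: mult.assoc)
           (simp add: mult.assoc mult_exp_exp)
      finally show "norm (iter_deriv \<beta> ?R x) \<le> K / a ^ Suc N * exp (\<gamma> * \<bar>x\<bar>)"
        by (simp only: j(2))
    qed
    moreover have "K > 0" using M \<delta> by (simp add: K_def)
    ultimately show ?thesis by blast
  qed
qed

section \<open>The asymptotic expansion\<close>

lemma test_dual_taylor_remainder:
  assumes \<psi>: "\<psi> \<in> test_space" and f: "f \<in> test_dual"
  shows "\<exists>C>0. \<forall>a\<ge>1. norm (f (taylor_remainder \<psi> b N a)) \<le> C / a ^ Suc N"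
proof -
  obtain S C where S: "finite S" "\<forall>(\<gamma>, \<beta>)\<in>S. \<gamma> > 0" "C > 0"
    and fb: "\<And>\<phi> K. \<phi> \<in> test_space \<Longrightarrow> K > 0 \<Longrightarrow>
      \<forall>(\<gamma>, \<beta>)\<in>S. test_seminorm \<gamma> \<beta> \<phi> \<le> K \<Longrightarrow> norm (f \<phi>) \<le> C * K"
    using test_dual_bound[OF f] by blast
  have "\<forall>s\<in>S. \<exists>K>0. \<forall>a\<ge>1. test_seminorm (fst s) (snd s) (taylor_remainder \<psi> b N a) \<le> K / a ^ Suc N"
    using S(2) taylor_remainder_seminorm[OF \<psi>] by force
  then obtain k where k: "\<And>s. s \<in> S \<Longrightarrow> k s > 0" "\<And>s a. s \<in> S \<Longrightarrow> a \<ge> 1 \<Longrightarrow>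
      test_seminorm (fst s) (snd s) (taylor_remainder \<psi> b N a) \<le> k s / a ^ Suc N"
    by metis
  \<comment> \<open>The sum dominates each \<open>k s\<close>; the summand 1 keeps \<open>K\<close> positive if \<open>S\<close> is empty.\<close>
  define K where "K = 1 + sum k S"
  have K: "K > 0" using k(1) by (simp add: K_def add_pos_nonneg sum_nonneg less_imp_le)
  have kK: "k s \<le> K" if "s \<in> S" for s
    using member_le_sum[of s S k] that S(1) k(1) by (force simp: K_def less_imp_le)
  have "norm (f (taylor_remainder \<psi> b N a)) \<le> C * (K / a ^ Suc N)" if a: "a \<ge> 1" for a
  proof (rule fb[OF taylor_remainder_test_space[OF \<psi> a]])
    have "k s / a ^ Suc N \<le> K / a ^ Suc N" if "s \<in> S" for s
      using kK[OF that] a by (intro divide_right_mono) auto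
    then show "\<forall>(\<gamma>, \<beta>)\<in>S. test_seminorm \<gamma> \<beta> (taylor_remainder \<psi> b N a) \<le> K / a ^ Suc N"
      using k(2) a by fastforce
  qed (use K a in simp)
  then show ?thesis
    using S(3) K by (intro exI[of _ "C * K"]) auto
qed

text \<open>Apply \<open>f\<close> to the Taylor formula term by term. The powers of \<open>a\<close> match because
  \<open>sqrt a / a = a powr (- 1 / 2)\<close>.\<close>

lemma wavelet_transform_minus_partial_sum:
  assumes \<psi>: "\<psi> \<in> test_space" and f: "f \<in> test_dual" and a: "a \<ge> 1"
  shows "of_real (sqrt a) * dilate a f (\<lambda>x. \<psi> (x - b / a)) -
     (\<Sum>\<alpha>\<le>N. moment f \<alpha> * iter_deriv \<alpha> \<psi> (- b / a) / of_real (fact \<alpha> * a powr (real \<alpha> + 1 / 2)))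
   = of_real (a powr (- 1 / 2)) * f (taylor_remainder \<psi> b N a)"
proof -
  let ?c = "\<lambda>k. iter_deriv k \<psi> (- b / a) / of_real (a ^ k)"
  let ?p = "\<lambda>k x. ?c k * of_real (x ^ k / fact k)"
  have p: "?p k \<in> test_space" for k
    by (rule test_space_cmult[OF test_space_power])
  have fp: "f (?p k) = ?c k * (moment f k / of_real (fact k))" for k
  proof -
    have pow: "(\<lambda>x. of_real x ^ k) = (\<lambda>x. fact k * (of_real (x ^ k / fact k) :: complex))"
      by simp
    have "moment f k = fact k * f (\<lambda>x. of_real (x ^ k / fact k))"
      unfolding moment_def pow by (rule test_dual_cmult[OF f test_space_power])
    then show ?thesis
      unfolding test_dual_cmult[OF f test_space_power] by simp
  qed
  have "(\<lambda>x. \<psi> ((x - b) / a)) = (\<lambda>x. taylor_remainder \<psi> b N a x + (\<Sum>k\<le>N. ?p k x))"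
    by (simp add: taylor_remainder_def)
  then have "f (\<lambda>x. \<psi> ((x - b) / a)) = f (\<lambda>x. taylor_remainder \<psi> b N a x + (\<Sum>k\<le>N. ?p k x))"
    by (rule arg_cong)
  also have "\<dots> = f (taylor_remainder \<psi> b N a) + f (\<lambda>x. \<Sum>k\<le>N. ?p k x)"
    by (rule test_dual_add[OF f taylor_remainder_test_space[OF \<psi> a] test_space_sum[OF p]])
  also have "f (\<lambda>x. \<Sum>k\<le>N. ?p k x) = (\<Sum>k\<le>N. f (?p k))"
    by (rule test_dual_sum[OF f p])
  finally have exp: "f (\<lambda>x. \<psi> ((x - b) / a)) = f (taylor_remainder \<psi> b N a)
      + (\<Sum>k\<le>N. ?c k * (moment f k / of_real (fact k)))"
    by (simp only: fp)
  have root: "sqrt a * (1 / a) = a powr (- 1 / 2)"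
    using a by (simp add: powr_half_sqrt[symmetric] powr_minus_divide field_simps flip: powr_add)
  have "of_real (sqrt a) * dilate a f (\<lambda>x. \<psi> (x - b / a))
      = of_real (a powr (- 1 / 2)) * f (\<lambda>x. \<psi> ((x - b) / a))"
    unfolding dilate_def root[symmetric] by (simp add: diff_divide_distrib)
  moreover have "moment f k * iter_deriv k \<psi> (- b / a) / of_real (fact k * a powr (real k + 1 / 2))
      = of_real (a powr (- 1 / 2)) * (?c k * (moment f k / of_real (fact k)))" for k
  proof -
    have eq: "a powr (real k + 1 / 2) = a ^ k / a powr (- 1 / 2)"
      using a by (simp add: powr_add powr_realpow powr_minus_divide)
    show ?thesis unfolding eq by (simp add: mult_ac)
  qed
  ultimately show ?thesis
    by (simp add: exp algebra_simps sum_distrib_left)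
qed

theorem theorem3p1:
  fixes \<psi> :: "real \<Rightarrow> complex" and f :: "(real \<Rightarrow> complex) \<Rightarrow> complex" and b :: real
  assumes "\<psi> \<in> test_space" and "f \<in> test_dual"
  shows "asymp_expansion
    (\<lambda>a. of_real (sqrt a) * dilate a f (\<lambda>x. \<psi> (x - b / a)))
    (\<lambda>\<alpha> a. moment f \<alpha> * iter_deriv \<alpha> \<psi> (- b / a) /
       of_real (fact \<alpha> * a powr (real \<alpha> + 1 / 2)))
    (\<lambda>\<alpha> a. a powr (- real \<alpha> - 1 / 2))"
  unfolding asymp_expansion_def
proof (intro allI landau_o.smallI)
  fix N and c :: real
  assume c: "c > 0"
  obtain C where C: "C > 0"
    "\<And>a. a \<ge> 1 \<Longrightarrow> norm (f (taylor_remainder \<psi> b N a)) \<le> C / a ^ Suc N"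
    using test_dual_taylor_remainder[OF assms] by metis
  \<comment> \<open>The remainder is smaller than the gauge by the factor \<open>C / a\<close>, which is at most \<open>c\<close> from
    \<open>C / c\<close> on.\<close>
  have "eventually (\<lambda>a. a \<ge> max 1 (C / c)) at_top"
    by (rule eventually_ge_at_top)
  then show "eventually (\<lambda>a. norm (of_real (sqrt a) * dilate a f (\<lambda>x. \<psi> (x - b / a)) -
      (\<Sum>\<alpha>\<le>N. moment f \<alpha> * iter_deriv \<alpha> \<psi> (- b / a) /
        of_real (fact \<alpha> * a powr (real \<alpha> + 1 / 2))))
      \<le> c * norm (complex_of_real (a powr (- real N - 1 / 2)))) at_top"
  proof eventually_elim
    fix a :: real
    assume "max 1 (C / c) \<le> a"
    then have a: "a \<ge> 1" and "C \<le> c * a" using c by (auto simp: field_simps)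
    have "norm (f (taylor_remainder \<psi> b N a)) \<le> C / a ^ Suc N"
      by (rule C(2)[OF a])
    also have "\<dots> \<le> c * a / a ^ Suc N"
      using \<open>C \<le> c * a\<close> a by (intro divide_right_mono) auto
    also have "\<dots> = c * a powr (- real N)"
      using a by (simp add: powr_minus_divide powr_realpow)
    finally have "a powr (- 1 / 2) * norm (f (taylor_remainder \<psi> b N a))
        \<le> a powr (- 1 / 2) * (c * a powr (- real N))"
      by (intro mult_left_mono) auto
    also have "\<dots> = c * a powr (- real N - 1 / 2)"
      by (simp add: mult_ac flip: powr_add)
    finally show "norm (of_real (sqrt a) * dilate a f (\<lambda>x. \<psi> (x - b / a)) -
      (\<Sum>\<alpha>\<le>N. moment f \<alpha> * iter_deriv \<alpha> \<psi> (- b / a) /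
        of_real (fact \<alpha> * a powr (real \<alpha> + 1 / 2))))
      \<le> c * norm (complex_of_real (a powr (- real N - 1 / 2)))"
      unfolding wavelet_transform_minus_partial_sum[OF assms a] by (simp add: norm_mult)
  qed
qed

end
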